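(* Let $d\ge2$ and $h'\ge 0$ be integers and let $h\ge\max\{2,\sqrt d\}$. Let $T$ be a $d$-branch tree of effective height at least $h'$ and height at most $h$. Then \[\phi(T)\;\ge\;\left\lceil\sqrt{\frac{h'}{\log_d h}}\,\right\rceil.\]
   Context: An anagram is a word of the form $WP$ where $W$ is a non-empty word and $P$ is a permutation of $W$. A vertex colouring of a graph is anagram-free if the sequence of colours along every path of the graph is not an anagram. $\phi(G)$ is the minimum number of colours in an anagram-free colouring of $G$. Let $T$ be a rooted tree with root $r$; its height is the maximum distance from $r$ to a vertex. A branch vertex is a vertex with at least two children. The effective height of $T$ is the minimum, over all leaves of $T$, of the number of branch vertices on the path from $r$ to that leaf. A $d$-branch tree is a rooted tree in which every branch vertex has at least $d$ children. *)

theory Defs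
  imports
    Complex_Main
    "HOL-Library.Multiset"
    "Graph_Theory.Digraph_Component"
    "Graph_Theory.Vertex_Walk"
begin

section \<open>Anagram-free colourings\<close>

definition anagram :: "'c list \<Rightarrow> bool" where
  "anagram w \<longleftrightarrow> (\<exists>W P. w = W @ P \<and> W \<noteq> [] \<and> mset P = mset W)"

text \<open>
  Finite simple graphs are rendered as in the library, by the locale \<^locale>\<open>graph\<close>: an
  undirected edge is a pair of opposite arcs. Paths are lists of vertices, see \<^const>\<open>vpath\<close>.
\<close>

definition anagram_free_colouring :: "('a, 'b) pre_digraph \<Rightarrow> ('a \<Rightarrow> 'c) \<Rightarrow> bool" where
  "anagram_free_colouring G f \<longleftrightarrow> (\<forall>p. vpath p G \<longrightarrow> \<not> anagram (map f p))"

definition anagram_free_colourable :: "('a, 'b) pre_digraph \<Rightarrow> nat \<Rightarrow> bool" where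
  "anagram_free_colourable G k \<longleftrightarrow>
     (\<exists>f :: 'a \<Rightarrow> nat. f ` verts G \<subseteq> {..<k} \<and> anagram_free_colouring G f)"

definition anagram_chromatic_number :: "('a, 'b) pre_digraph \<Rightarrow> nat" (\<open>\<phi>\<close>) where
  "\<phi> G = (LEAST k. anagram_free_colourable G k)"


section \<open>Rooted trees\<close>

text \<open>
  The library predicates \<^const>\<open>forest\<close> and \<^const>\<open>tree\<close> cannot be used here: they
  count the closed walk \<open>a, b, a\<close> along a single undirected edge as a cycle. In a simple symmetric
  digraph, the cycles of length at least 3 are exactly the cycles of the undirected graph.
\<close>

locale rooted_tree = graph T for T :: "('a, 'b) pre_digraph" +
  fixes r :: 'a
  assumes connected: "Digraph_Component.connected T"
    and acyclic: "\<not> (\<exists>p. cycle p \<and> 3 \<le> length p)"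
    and root: "r \<in> verts T"

definition graph_dist :: "('a, 'b) pre_digraph \<Rightarrow> 'a \<Rightarrow> 'a \<Rightarrow> nat" where
  "graph_dist G u v = (LEAST n. \<exists>p. vpath p G \<and> hd p = u \<and> last p = v \<and> vwalk_length p = n)"

definition tree_path :: "('a, 'b) pre_digraph \<Rightarrow> 'a \<Rightarrow> 'a \<Rightarrow> 'a list" where
  "tree_path T u v = (THE p. vpath p T \<and> hd p = u \<and> last p = v)"

definition tree_height :: "('a, 'b) pre_digraph \<Rightarrow> 'a \<Rightarrow> nat" where
  "tree_height T r = Max (graph_dist T r ` verts T)"

definition children :: "('a, 'b) pre_digraph \<Rightarrow> 'a \<Rightarrow> 'a \<Rightarrow> 'a set" where
  "children T r v = {w. v \<rightarrow>\<^bsub>T\<^esub> w \<and> graph_dist T r w = Suc (graph_dist T r v)}"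

definition branch_vertices :: "('a, 'b) pre_digraph \<Rightarrow> 'a \<Rightarrow> 'a set" where
  "branch_vertices T r = {v \<in> verts T. 2 \<le> card (children T r v)}"

text \<open>
  A leaf is a vertex without children; thus the root is a leaf only if it is the only vertex,
  even if its degree is 1.
\<close>

definition leaves :: "('a, 'b) pre_digraph \<Rightarrow> 'a \<Rightarrow> 'a set" where
  "leaves T r = {v \<in> verts T. children T r v = {}}"

definition effective_height :: "('a, 'b) pre_digraph \<Rightarrow> 'a \<Rightarrow> nat" where
  "effective_height T r =
     Min ((\<lambda>l. card (set (tree_path T r l) \<inter> branch_vertices T r)) ` leaves T r)"

definition branch_tree :: "nat \<Rightarrow> ('a, 'b) pre_digraph \<Rightarrow> 'a \<Rightarrow> bool" where
  "branch_tree d T r \<longleftrightarrow>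
     rooted_tree T r \<and> (\<forall>v \<in> branch_vertices T r. d \<le> card (children T r v))"

end

theory Submission
  imports Defs
begin

text \<open>
  Let \<open>k\<close> be the number of colours and \<open>H\<close> the height. To every path from the root to a leaf
  attach, for each colour \<open>c\<close>, the multiset of colours met up to the last occurrence of \<open>c\<close>. Since
  of any two colours one has all its occurrences before the last occurrence of the other, these
  \<open>k\<close> multisets together take at most \<open>H ^ (k * (k + 1) div 2)\<close> values. If two paths with the
  same value separate at a vertex \<open>w\<close> whose colour recurs below \<open>w\<close> on one of them, then cutting
  both at the last occurrence of that colour yields an anagram through \<open>w\<close>. Hence \<open>w\<close> is the
  last vertex of its colour on both paths, which happens for at most \<open>k - 1\<close> of the branch
  vertices of a path. A Kraft-type inequality turns this into
  \<open>d ^ h' \<le> H ^ (k * (k + 1) div 2) * d ^ (k - 1)\<close>, and with \<open>d \<le> h ^ 2\<close> this is at most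
  \<open>h ^ k ^ 2\<close> for \<open>k \<ge> 4\<close>. For \<open>k \<le> 3\<close> the anagram-free words are so short that
  \<open>2 * h' \<le> k ^ 2\<close>, and \<open>d \<le> h ^ 2\<close> suffices.
\<close>


section \<open>Anagram-free words\<close>

definition factor_free :: "'c list \<Rightarrow> bool" where
  "factor_free w \<longleftrightarrow> (\<forall>x y z. w = x @ y @ z \<longrightarrow> \<not> anagram y)"

lemma factor_free_Cons: "factor_free (c # w) \<Longrightarrow> factor_free w"
  unfolding factor_free_def by (metis append_Cons)

lemma factor_free_adjacent: "factor_free w \<Longrightarrow> w \<noteq> x @ [a, a] @ y"
proof -
  have "anagram [a, a]"
    unfolding anagram_def by (intro exI[of _ "[a]"]) auto
  then show "factor_free w \<Longrightarrow> w \<noteq> x @ [a, a] @ y"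
    unfolding factor_free_def by blast
qed

text \<open>Multisets are compared by sorting so that the search for anagram-free words is computable.\<close>

definition prefix_anagram :: "nat list \<Rightarrow> bool" where
  "prefix_anagram w \<longleftrightarrow>
     (\<exists>m \<in> set [1..<Suc (length w div 2)]. sort (take m w) = sort (take m (drop m w)))"

lemma prefix_anagram_not_factor_free:
  assumes "prefix_anagram w" shows "\<not> factor_free w"
proof -
  obtain m where m: "m \<ge> 1" "m \<le> length w div 2" "sort (take m w) = sort (take m (drop m w))"
    using assms by (auto simp: prefix_anagram_def)
  then have "take m w \<noteq> []" by (cases w) auto
  moreover have "mset (take m w) = mset (take m (drop m w))"
    using m(3) by (metis mset_sort)
  ultimately have "anagram (take m w @ take m (drop m w))"
    unfolding anagram_def by metis
  moreover have "w = [] @ (take m w @ take m (drop m w)) @ drop m (drop m w)"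
    by (metis append.assoc append_Nil append_take_drop_id)
  ultimately show ?thesis
    unfolding factor_free_def by blast
qed

text \<open>Words grow at the front and the tails are filtered already, so a new anagram can only be
  a prefix.\<close>

fun free_words :: "nat \<Rightarrow> nat \<Rightarrow> nat list list" where
  "free_words k 0 = [[]]"
| "free_words k (Suc n) =
     filter (\<lambda>w. \<not> prefix_anagram w) [c # w. w \<leftarrow> free_words k n, c \<leftarrow> [0..<k]]"

lemma factor_free_in_free_words:
  "factor_free w \<Longrightarrow> set w \<subseteq> {..<k} \<Longrightarrow> w \<in> set (free_words k (length w))"
proof (induction w)
  case (Cons c w)
  then have "\<not> prefix_anagram (c # w)" "w \<in> set (free_words k (length w))" "c \<in> {0..<k}"
    using prefix_anagram_not_factor_free[of "c # w"] factor_free_Cons[of c w] by auto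
  then show ?case by (auto intro!: bexI[of _ w])
qed simp

lemma free_words_empty: "free_words 1 2 = []" "free_words 2 4 = []" "free_words 3 8 = []"
  by code_simp+

lemma free_words_mono: "free_words k n = [] \<Longrightarrow> n \<le> m \<Longrightarrow> free_words k m = []"
  by (induction m) (auto simp: le_Suc_eq)

lemma factor_free_length:
  fixes k :: nat
  assumes "factor_free w" "set w \<subseteq> {..<k}"
  shows "k \<le> 1 \<Longrightarrow> length w \<le> 1" "k = 2 \<Longrightarrow> length w \<le> 3" "k = 3 \<Longrightarrow> length w \<le> 7"
proof -
  \<comment> \<open>Enlarging the alphabet to \<open>j\<close> lets the search over one letter cover
    \<open>k = 0\<close>.\<close>
  have *: "length w < n" if "free_words j n = []" "k \<le> j" for n j
  proof (rule ccontr)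
    assume "\<not> length w < n"
    then have "free_words j (length w) = []" using that(1) free_words_mono by simp
    moreover have "set w \<subseteq> {..<j}" using assms(2) that(2) by auto
    ultimately show False using factor_free_in_free_words[OF assms(1), of j] by simp
  qed
  show "k \<le> 1 \<Longrightarrow> length w \<le> 1" "k = 2 \<Longrightarrow> length w \<le> 3" "k = 3 \<Longrightarrow> length w \<le> 7"
    using *[OF free_words_empty(1)] *[OF free_words_empty(2)] *[OF free_words_empty(3)] by auto
qed

section \<open>Prefixes ending at the last occurrence of a letter\<close>

definition upto_last :: "'c \<Rightarrow> 'c list \<Rightarrow> 'c list" where
  "upto_last c w = rev (dropWhile (\<lambda>x. x \<noteq> c) (rev w))"

lemma upto_last_snoc [simp]:
  "upto_last c [] = []"
  "upto_last c (w @ [x]) = (if x = c then w @ [x] else upto_last c w)"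
  by (simp_all add: upto_last_def)

lemma upto_last_append: "c \<notin> set z \<Longrightarrow> upto_last c (y @ c # z) = y @ [c]"
proof (induction z rule: rev_induct)
  case (snoc x z)
  then show ?case using upto_last_snoc(2)[of c "y @ c # z" x] by auto
qed simp

lemma length_upto_last_le: "length (upto_last c w) \<le> length w"
  by (simp add: upto_last_def length_dropWhile_le order_trans[OF length_dropWhile_le])

text \<open>For fixed \<open>b\<close> these are the multiplicities in the multiset attached to
  \<open>b\<close>; all are 0 if \<open>b\<close> does not occur.\<close>

definition before_last :: "'c list \<Rightarrow> 'c \<Rightarrow> 'c \<Rightarrow> nat" where
  "before_last w a b = count_list (upto_last b w) a"

lemma before_last_le: "before_last w a b \<le> count_list w a"
  by (induction w rule: rev_induct) (auto simp: before_last_def)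

lemma before_last_self: "before_last w a a = count_list w a"
  by (induction w rule: rev_induct) (auto simp: before_last_def)

text \<open>The prefix ending at the later of the two last occurrences holds every copy of the other
  letter. The shorter prefix misses at least that later occurrence, whence the strict
  inequalities.\<close>

lemma before_last_cases:
  assumes "a \<noteq> b"
  shows "before_last w a b = count_list w a \<and> before_last w b a < count_list w b
    \<or> before_last w b a = count_list w b \<and> before_last w a b < count_list w a
    \<or> count_list w a = 0 \<and> count_list w b = 0"
  using assms
proof (induction w rule: rev_induct)
  case (snoc x w)
  then show ?case
    using before_last_le[of w a b] before_last_le[of w b a]
    by (auto simp: before_last_def less_Suc_eq_le)
qed simp

text \<open>
  Of the two letters \<open>a\<close> and \<open>b\<close>, one has all its occurrences before the last occurrence
  of the other, so only one of the two numbers in question carries information. Together they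
  take at most \<open>count_list w a + count_list w b\<close> values.
\<close>

definition pair_code :: "'c list \<Rightarrow> 'c \<times> 'c \<Rightarrow> nat" where
  "pair_code w = (\<lambda>(a, b). if a = b then count_list w a
     else if before_last w a b = count_list w a then before_last w b a
     else count_list w b + before_last w a b)"

text \<open>Strictness separates the two branches of \<open>pair_code\<close>: the first stays below
  \<open>count_list w b\<close> unless neither letter occurs, the second does not. So the code,
  given the counts, reveals the branch and the missing number.\<close>

lemma before_last_eqI:
  assumes "pair_code v (a, b) = pair_code w (a, b)"
    and "count_list v a = count_list w a" "count_list v b = count_list w b"
  shows "before_last v a b = before_last w a b \<and> before_last v b a = before_last w b a"
proof (cases "a = b")
  case False
  then show ?thesis
    using assms before_last_cases[OF False, of v] before_last_cases[OF False, of w]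
      before_last_le[of v a b] before_last_le[of w a b] before_last_le[of v b a] before_last_le[of w b a]
    by (auto simp: pair_code_def split: if_splits)
qed (use assms in \<open>simp add: before_last_self\<close>)

lemma count_list_add_le: "a \<noteq> b \<Longrightarrow> count_list w a + count_list w b \<le> length w"
  by (induction w) auto

text \<open>Off the diagonal the code is 0 or less than the two counts together. On the diagonal,
  one of the first two letters differs from \<open>a\<close>, as equal neighbours form an anagram;
  \<open>2 \<le> n\<close> settles one-letter words.\<close>

lemma pair_code_less:
  assumes "factor_free w" "length w \<le> n" "2 \<le> n"
  shows "pair_code w (a, b) < n"
proof (cases "a = b")
  case True
  have "count_list w a < n"
  proof (cases w)
    case (Cons x v)
    show ?thesis
    proof (cases v)
      case (Cons y u)
      then have "x \<noteq> y" using factor_free_adjacent[OF assms(1), of "[]" x u] \<open>w = x # v\<close> by auto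
      then have "count_list w a \<le> Suc (count_list u a)" "length w = Suc (Suc (length u))"
        using Cons \<open>w = x # v\<close> by auto
      then show ?thesis using count_le_length[of u a] assms(2) by linarith
    qed (use Cons assms in auto)
  qed (use assms in auto)
  with True show ?thesis by (simp add: pair_code_def)
next
  case False
  then show ?thesis
    using before_last_cases[OF False, of w] count_list_add_le[OF False, of w] assms
      before_last_le[of w a b] before_last_le[of w b a]
    by (auto simp: pair_code_def)
qed

text \<open>
  Deleting everything after the last \<open>c\<close> on both sides, and then the last \<open>c\<close> on one of them,
  turns two descending words with equal codes into the two halves of an anagram.
\<close>

lemma anagram_of_equal_codes:
  fixes p q s :: "nat list"
  assumes codes: "\<And>a b. a \<le> b \<Longrightarrow> b < k \<Longrightarrow> pair_code (s @ p) (a, b) = pair_code (s @ q) (a, b)"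
    and letters: "set (s @ p) \<subseteq> {..<k}" "set (s @ q) \<subseteq> {..<k}"
    and c: "c \<in> set p"
  shows "\<exists>p1 p2 q1 q2. p = p1 @ c # p2 \<and> q = q1 @ c # q2 \<and> anagram (c # rev p1 @ c # q1)"
proof -
  have "c < k" using c letters by auto
  have count: "count_list (s @ p) a = count_list (s @ q) a" if "a < k" for a
    using codes[of a a] that by (simp add: pair_code_def)
  have bl: "before_last (s @ p) a c = before_last (s @ q) a c" if "a < k" for a
    using that \<open>c < k\<close> codes[of a c] codes[of c a] count[of a] count[of c]
      before_last_eqI[of "s @ p" a c "s @ q"] before_last_eqI[of "s @ p" c a "s @ q"]
    by (cases "a \<le> c") auto
  have sub: "set (upto_last c w) \<subseteq> set w" for w :: "nat list"
    by (auto simp: upto_last_def dest: set_dropWhileD)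
  have "count_list (upto_last c (s @ p)) a = count_list (upto_last c (s @ q)) a" for a
  proof (cases "a < k")
    case False
    then have "a \<notin> set (s @ p)" "a \<notin> set (s @ q)" using letters by auto
    then have "a \<notin> set (upto_last c (s @ p))" "a \<notin> set (upto_last c (s @ q))" using sub by blast+
    then show ?thesis by (simp add: count_list_0_iff)
  qed (use bl in \<open>simp add: before_last_def\<close>)
  then have M: "mset (upto_last c (s @ p)) = mset (upto_last c (s @ q))"
    by (intro multiset_eqI) (simp add: count_mset)
  obtain p1 p2 where p: "p = p1 @ c # p2" "c \<notin> set p2"
    using split_list_last[OF c] by blast
  have P: "upto_last c (s @ p) = s @ p1 @ [c]"
    using upto_last_append[OF p(2), of "s @ p1"] p(1) by simp
  \<comment> \<open>Otherwise truncation on the side of \<open>q\<close> would end within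
    \<open>s\<close> and leave too few letters.\<close>
  have "c \<in> set q"
  proof (rule ccontr)
    assume "c \<notin> set q"
    then have "length (upto_last c (s @ q)) \<le> length s"
    proof (induction q rule: rev_induct)
      case Nil
      then show ?case by (simp add: length_upto_last_le)
    next
      case (snoc x q)
      then show ?case using upto_last_snoc(2)[of c "s @ q" x] by auto
    qed
    moreover have "length (upto_last c (s @ q)) = length (s @ p1 @ [c])"
      using M P by (metis mset_eq_length)
    ultimately show False by simp
  qed
  then obtain q1 q2 where q: "q = q1 @ c # q2" "c \<notin> set q2"
    using split_list_last by metis
  have "upto_last c (s @ q) = s @ q1 @ [c]"
    using upto_last_append[OF q(2), of "s @ q1"] q(1) by simp
  with M P have "mset p1 = mset q1" by simp
  \<comment> \<open>The middle \<open>c\<close> is taken from neither \<open>p\<close> nor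
    \<open>q\<close>: it will be the colour of the vertex where the two paths separate.\<close>
  then have "anagram ((c # rev p1) @ (c # q1))"
    unfolding anagram_def by (intro exI[of _ "c # rev p1"] exI[of _ "c # q1"]) simp
  with p q show ?thesis by auto
qed


section \<open>Weights of descending paths\<close>

inductive descent :: "('a \<Rightarrow> 'a set) \<Rightarrow> 'a \<Rightarrow> 'a list \<Rightarrow> bool" for ch where
  leaf: "ch v = {} \<Longrightarrow> descent ch v [v]"
| step: "w \<in> ch v \<Longrightarrow> descent ch w p \<Longrightarrow> descent ch v (v # p)"

definition descents :: "('a \<Rightarrow> 'a set) \<Rightarrow> 'a \<Rightarrow> 'a list set" where
  "descents ch v = {p. descent ch v p}"

lemma descents_leaf: "ch v = {} \<Longrightarrow> descents ch v = {[v]}"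
  by (auto simp: descents_def intro: descent.intros elim: descent.cases)

lemma descents_branch: "ch v \<noteq> {} \<Longrightarrow> descents ch v = (\<Union>w \<in> ch v. (#) v ` descents ch w)"
  unfolding descents_def by (rule set_eqI, simp add: image_iff, subst descent.simps, blast)

lemma descents_hd: "p \<in> descents ch v \<Longrightarrow> p \<noteq> [] \<and> hd p = v"
  by (auto simp: descents_def elim: descent.cases)

lemma descent_split: "descent ch v p \<Longrightarrow> p = x @ w # y \<Longrightarrow> descent ch w (w # y)"
proof (induction arbitrary: x rule: descent.induct)
  case (leaf v)
  then show ?case by (auto simp: Cons_eq_append_conv intro: descent.intros)
next
  case (step u v p)
  then show ?case by (cases x) (auto intro: descent.intros)
qed

text \<open>
  Call a vertex of a descending path lossy if its colour does not recur further down. Two paths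
  with equal codes may only separate at a vertex that is lossy for both, since otherwise they
  give an anagram.
\<close>

fun lossy_weight :: "('a \<Rightarrow> 'a set) \<Rightarrow> ('a \<Rightarrow> 'c) \<Rightarrow> 'a list \<Rightarrow> real" where
  "lossy_weight ch f [] = 1"
| "lossy_weight ch f (v # p) =
     (if p \<noteq> [] \<and> f v \<notin> f ` set p then 1 / card (ch v) else 1) * lossy_weight ch f p"

text \<open>The probability of the path under a walk that moves to a uniformly chosen child. The
  last vertex is exempt because a leaf would contribute \<open>1 / 0 = 0\<close>.\<close>

fun harmonic_weight :: "('a \<Rightarrow> 'a set) \<Rightarrow> 'a list \<Rightarrow> real" where
  "harmonic_weight ch [] = 1"
| "harmonic_weight ch (v # p) = (if p = [] then 1 else 1 / card (ch v)) * harmonic_weight ch p"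

lemma lossy_weight_nonneg: "lossy_weight ch f p \<ge> 0"
  by (induction p) auto

lemma harmonic_weight_nonneg: "harmonic_weight ch p \<ge> 0"
  by (induction p) auto

text \<open>Exchanging \<open>p\<close> and \<open>q\<close> shows that \<open>w\<close> is lossy on
  both paths.\<close>

definition lossy_family :: "('a \<Rightarrow> 'c) \<Rightarrow> 'a list set \<Rightarrow> bool" where
  "lossy_family f U \<longleftrightarrow> (\<forall>x w p q. x @ w # p \<in> U \<longrightarrow> x @ w # q \<in> U \<longrightarrow> p \<noteq> [] \<longrightarrow> q \<noteq> [] \<longrightarrow>
     hd p \<noteq> hd q \<longrightarrow> f w \<notin> f ` set p)"

lemma lossy_familyD:
  "lossy_family f U \<Longrightarrow> x @ w # p \<in> U \<Longrightarrow> x @ w # q \<in> U \<Longrightarrow> p \<noteq> [] \<Longrightarrow> q \<noteq> [] \<Longrightarrow> hd p \<noteq> hd q \<Longrightarrow>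
     f w \<notin> f ` set p"
  unfolding lossy_family_def by blast

section \<open>Sums of weights over all descending paths\<close>

locale ranked_tree =
  fixes ch :: "'a \<Rightarrow> 'a set" and rank :: "'a \<Rightarrow> nat"
  assumes finite_ch: "finite (ch v)"
    and rank_ch: "w \<in> ch v \<Longrightarrow> rank w < rank v"
begin

lemma tree_induct [case_names step]:
  assumes "\<And>v. (\<And>w. w \<in> ch v \<Longrightarrow> P w) \<Longrightarrow> P v"
  shows "P v"
  by (induction v rule: measure_induct_rule[of rank]) (use assms rank_ch in blast)

lemma finite_descents: "finite (descents ch v)"
proof (induction v rule: tree_induct)
  case (step v)
  then show ?case
    by (cases "ch v = {}") (auto simp: descents_leaf descents_branch finite_ch)
qed

lemma descents_nonempty: "descents ch v \<noteq> {}"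
proof (induction v rule: tree_induct)
  case (step v)
  then show ?case
    by (cases "ch v = {}") (auto simp: descents_leaf descents_branch)
qed

lemma sum_descents:
  assumes "ch v \<noteq> {}"
  shows "(\<Sum>p \<in> descents ch v. g p) = (\<Sum>w \<in> ch v. \<Sum>p \<in> descents ch w. g (v # p))"
proof -
  have "(\<Sum>p \<in> descents ch v. g p) = (\<Sum>w \<in> ch v. \<Sum>p \<in> (#) v ` descents ch w. g p)"
    unfolding descents_branch[of ch, OF assms]
  proof (rule sum.UNION_disjoint)
    show "\<forall>i\<in>ch v. \<forall>j\<in>ch v. i \<noteq> j \<longrightarrow> (#) v ` descents ch i \<inter> (#) v ` descents ch j = {}"
      by (auto dest!: descents_hd)
  qed (auto simp: finite_ch finite_descents)
  also have "\<dots> = (\<Sum>w \<in> ch v. \<Sum>p \<in> descents ch w. g (v # p))"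
    by (simp add: sum.reindex)
  finally show ?thesis .
qed

lemma sum_harmonic_weight: "(\<Sum>p \<in> descents ch v. harmonic_weight ch p) = 1"
proof (induction v rule: tree_induct)
  case (step v)
  show ?case
  proof (cases "ch v = {}")
    case False
    have "(\<Sum>p \<in> descents ch v. harmonic_weight ch p)
        = (\<Sum>w \<in> ch v. \<Sum>p \<in> descents ch w. harmonic_weight ch p / card (ch v))"
      unfolding sum_descents[OF False] using descents_hd by (intro sum.cong refl) fastforce
    also have "\<dots> = (\<Sum>w \<in> ch v. 1 / card (ch v))"
      using step by (simp flip: sum_divide_distrib)
    finally show ?thesis using False by (simp add: finite_ch)
  qed (simp add: descents_leaf)
qed

text \<open>
  A form of Kraft's inequality: wherever the family branches, the branching is lossy for all
  its members.
\<close>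

lemma sum_lossy_weight_le_1:
  "U \<subseteq> descents ch v \<Longrightarrow> lossy_family f U \<Longrightarrow> (\<Sum>p \<in> U. lossy_weight ch f p) \<le> 1"
proof (induction v arbitrary: U rule: tree_induct)
  case (step v)
  show ?case
  proof (cases "ch v = {}")
    case True
    then have "U = {} \<or> U = {[v]}" using step.prems by (auto simp: descents_leaf)
    then show ?thesis by auto
  next
    case False
    define V where "V w = {p \<in> descents ch w. v # p \<in> U}" for w
    have U: "U = (\<Union>w \<in> ch v. (#) v ` V w)"
      using step.prems(1) unfolding descents_branch[of ch, OF False] V_def by blast
    have finV: "finite (V w)" for w
      using finite_descents by (simp add: V_def)
    have lossyV: "lossy_family f (V w)" for w
      unfolding lossy_family_def V_def
    proof (intro allI impI)
      fix x u p q
      assume "x @ u # p \<in> {p \<in> descents ch w. v # p \<in> U}" "x @ u # q \<in> {p \<in> descents ch w. v # p \<in> U}"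
        "p \<noteq> []" "q \<noteq> []" "hd p \<noteq> hd q"
      then show "f u \<notin> f ` set p"
        by (intro lossy_familyD[OF step.prems(2), of "v # x" u p q]) auto
    qed
    have le1: "(\<Sum>p \<in> V w. lossy_weight ch f p) \<le> 1" if "w \<in> ch v" for w
      by (rule step.IH[OF that _ lossyV]) (auto simp: V_def)
    have sumU: "(\<Sum>p \<in> U. lossy_weight ch f p)
        = (\<Sum>w \<in> ch v. \<Sum>p \<in> V w. lossy_weight ch f (v # p))"
    proof -
      have "(\<Sum>p \<in> U. lossy_weight ch f p)
        = (\<Sum>w \<in> ch v. \<Sum>p \<in> (#) v ` V w. lossy_weight ch f p)"
        unfolding U
      proof (rule sum.UNION_disjoint)
        show "\<forall>i\<in>ch v. \<forall>j\<in>ch v. i \<noteq> j \<longrightarrow> (#) v ` V i \<inter> (#) v ` V j = {}"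
          by (auto simp: V_def dest!: descents_hd)
      qed (auto simp: finite_ch finV)
      also have "\<dots> = (\<Sum>w \<in> ch v. \<Sum>p \<in> V w. lossy_weight ch f (v # p))"
        by (simp add: sum.reindex)
      finally show ?thesis .
    qed
    show ?thesis
    proof (cases "\<exists>w1 \<in> ch v. \<exists>w2 \<in> ch v. w1 \<noteq> w2 \<and> V w1 \<noteq> {} \<and> V w2 \<noteq> {}")
      case True
      then obtain w1 w2 q1 q2 where w: "w1 \<noteq> w2" "q1 \<in> V w1" "q2 \<in> V w2"
        by blast
      \<comment> \<open>Each member of \<open>U\<close> leaves \<open>v\<close> by a different child
        than one of the paths through \<open>w1\<close> and \<open>w2\<close>, so \<open>v\<close>
        is lossy on it.\<close>
      have lossy: "f v \<notin> f ` set p" "p \<noteq> []" if "p \<in> V w" for p w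
      proof -
        obtain q where q: "v # q \<in> U" "q \<noteq> []" "hd q \<noteq> hd p"
          using w that descents_hd unfolding V_def by (smt (verit) mem_Collect_eq)
        show "p \<noteq> []" using that descents_hd[of p ch w] by (auto simp: V_def)
        with q show "f v \<notin> f ` set p"
          using lossy_familyD[OF step.prems(2), of "[]" v p q] that by (auto simp: V_def)
      qed
      have "(\<Sum>p \<in> U. lossy_weight ch f p)
          = (\<Sum>w \<in> ch v. (\<Sum>p \<in> V w. lossy_weight ch f p) / card (ch v))"
        unfolding sumU sum_divide_distrib using lossy by (intro sum.cong refl) simp
      also have "\<dots> \<le> (\<Sum>w \<in> ch v. 1 / card (ch v))"
        by (intro sum_mono divide_right_mono le1) auto
      also have "\<dots> = 1" using False by (simp add: finite_ch)
      finally show ?thesis .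
    next
      case one: False
      show ?thesis
      proof (cases "\<exists>w \<in> ch v. V w \<noteq> {}")
        case True
        then obtain w where w: "w \<in> ch v" "V w \<noteq> {}" by blast
        then have "V i = {}" if "i \<in> ch v - {w}" for i using one that by blast
        then have "(\<Sum>p \<in> U. lossy_weight ch f p)
            = (\<Sum>w \<in> {w}. \<Sum>p \<in> V w. lossy_weight ch f (v # p))"
          unfolding sumU using w by (intro sum.mono_neutral_right) (auto simp: finite_ch)
        also have "\<dots> = (\<Sum>p \<in> V w. lossy_weight ch f (v # p))" by simp
        \<comment> \<open>Only one child is used; whether or not \<open>v\<close> is lossy, its
          factor is at most 1.\<close>
        also have "\<dots> \<le> (\<Sum>p \<in> V w. lossy_weight ch f p)"
        proof (intro sum_mono)
          fix p
          have "1 \<le> card (ch v)" using False by (simp add: Suc_le_eq card_gt_0_iff finite_ch)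
          then have "(if p \<noteq> [] \<and> f v \<notin> f ` set p then 1 / card (ch v) else 1) \<le> (1::real)"
            by simp
          from mult_right_mono[OF this lossy_weight_nonneg[of ch f p]]
          show "lossy_weight ch f (v # p) \<le> lossy_weight ch f p"
            by (simp only: lossy_weight.simps mult_1)
        qed
        also have "\<dots> \<le> 1" by (rule le1[OF w(1)])
        finally show ?thesis .
      qed (use U in auto)
    qed
  qed
qed

text \<open>
  Each colour accounts for one lossy vertex per path, and the colour of the leaf for none.
\<close>

lemma harmonic_le_lossy_weight:
  assumes "p \<in> descents ch v" "0 < d"
    and "\<And>u. u \<in> set p \<Longrightarrow> 2 \<le> card (ch u) \<Longrightarrow> d \<le> card (ch u)"
  shows "real d ^ length (filter (\<lambda>u. 2 \<le> card (ch u)) p) * harmonic_weight ch p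
    \<le> lossy_weight ch f p * real d ^ (card (f ` set p) - 1)"
  using assms unfolding descents_def mem_Collect_eq
proof (induction rule: descent.induct)
  case (leaf v)
  then show ?case by simp
next
  case (step w v p)
  define b where "b = length (filter (\<lambda>u. 2 \<le> card (ch u)) p)"
  define m where "m = card (f ` set p) - 1"
  define e where "e = (if 2 \<le> card (ch v) then 1 else 0 :: nat)"
  have IH: "real d ^ b * harmonic_weight ch p \<le> lossy_weight ch f p * real d ^ m"
    using step unfolding b_def m_def by simp
  have p: "p \<noteq> []" using descents_hd[of p ch w] step by (simp add: descents_def)
  have c: "card (ch v) \<ge> 1"
    using step.hyps(1) by (auto simp: Suc_le_eq card_gt_0_iff finite_ch)
  have ed: "real d ^ e \<le> card (ch v)" "real d ^ e \<le> d"
    using step.prems(2)[of v] c \<open>0 < d\<close> by (auto simp: e_def)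
  have card: "card (f ` set (v # p)) - 1 = m + (if f v \<in> f ` set p then 0 else 1)"
  proof -
    have "card (f ` set p) > 0" using p by (simp add: card_gt_0_iff)
    then show ?thesis by (simp add: insert_absorb m_def)
  qed
  have "real d ^ length (filter (\<lambda>u. 2 \<le> card (ch u)) (v # p)) * harmonic_weight ch (v # p)
      = (real d ^ e / card (ch v)) * (real d ^ b * harmonic_weight ch p)"
    using p by (simp add: b_def e_def)
  also have "\<dots> \<le> (real d ^ e / card (ch v)) * (lossy_weight ch f p * real d ^ m)"
    by (intro mult_left_mono IH) simp
  \<comment> \<open>If the colour of \<open>v\<close> recurs, \<open>card (ch v)\<close> absorbs
    \<open>d ^ e\<close>. If not, the factor \<open>1 / card (ch v)\<close> stands on both sides and
    the new colour pays for \<open>d ^ e\<close>.\<close>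
  also have "\<dots> \<le> lossy_weight ch f (v # p) * real d ^ (card (f ` set (v # p)) - 1)"
  proof (cases "f v \<in> f ` set p")
    case True
    have "(real d ^ e / card (ch v)) * (lossy_weight ch f p * real d ^ m)
        \<le> 1 * (lossy_weight ch f p * real d ^ m)"
      using ed(1) c by (intro mult_right_mono mult_nonneg_nonneg lossy_weight_nonneg) auto
    then show ?thesis unfolding card using True by simp
  next
    case False
    have "(real d ^ e / card (ch v)) * (lossy_weight ch f p * real d ^ m)
        \<le> (real d / card (ch v)) * (lossy_weight ch f p * real d ^ m)"
      using ed(2) by (intro mult_right_mono divide_right_mono mult_nonneg_nonneg lossy_weight_nonneg) auto
    then show ?thesis unfolding card using False p by (simp add: mult_ac)
  qed
  finally show ?case .
qed

text \<open>The harmonic weights sum to 1, so \<open>d ^ m\<close> is an average over the paths.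
  Comparison with the lossy weights costs \<open>d ^ (k - 1)\<close>, and each class of
  \<open>\<Phi>\<close> has total lossy weight at most 1.\<close>

lemma branching_bound:
  assumes "0 < d"
    and "\<And>p u. p \<in> descents ch v \<Longrightarrow> u \<in> set p \<Longrightarrow> 2 \<le> card (ch u) \<Longrightarrow> d \<le> card (ch u)"
    and "\<And>p. p \<in> descents ch v \<Longrightarrow> m \<le> length (filter (\<lambda>u. 2 \<le> card (ch u)) p)"
    and "\<And>p. p \<in> descents ch v \<Longrightarrow> card (f ` set p) \<le> k"
    and "finite X" "\<And>p. p \<in> descents ch v \<Longrightarrow> \<Phi> p \<in> X"
    and "\<And>x. lossy_family f {p \<in> descents ch v. \<Phi> p = x}"
  shows "d ^ m \<le> card X * d ^ (k - 1)"
proof -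
  let ?D = "descents ch v"
  have "real d ^ m = (\<Sum>p \<in> ?D. real d ^ m * harmonic_weight ch p)"
    by (simp add: sum_harmonic_weight flip: sum_distrib_left)
  also have "\<dots> \<le> (\<Sum>p \<in> ?D. lossy_weight ch f p * real d ^ (k - 1))"
  proof (rule sum_mono)
    fix p assume p: "p \<in> ?D"
    have "real d ^ m * harmonic_weight ch p
        \<le> real d ^ length (filter (\<lambda>u. 2 \<le> card (ch u)) p) * harmonic_weight ch p"
      using assms(1) assms(3)[OF p] by (intro mult_right_mono power_increasing harmonic_weight_nonneg) auto
    also have "\<dots> \<le> lossy_weight ch f p * real d ^ (card (f ` set p) - 1)"
      using harmonic_le_lossy_weight[OF p assms(1)] assms(2)[OF p] by blast
    also have "\<dots> \<le> lossy_weight ch f p * real d ^ (k - 1)"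
      using assms(1) assms(4)[OF p] by (intro mult_left_mono power_increasing lossy_weight_nonneg) auto
    finally show "real d ^ m * harmonic_weight ch p \<le> lossy_weight ch f p * real d ^ (k - 1)" .
  qed
  also have "\<dots> = (\<Sum>p \<in> ?D. lossy_weight ch f p) * real d ^ (k - 1)"
    by (simp add: sum_distrib_right)
  also have "(\<Sum>p \<in> ?D. lossy_weight ch f p) = (\<Sum>x \<in> X. \<Sum>p \<in> {p \<in> ?D. \<Phi> p = x}. lossy_weight ch f p)"
    using assms(5,6) by (intro sum.group[symmetric] finite_descents) auto
  also have "\<dots> \<le> (\<Sum>x \<in> X. 1)"
    using assms(7) by (intro sum_mono sum_lossy_weight_le_1) auto
  finally have "real d ^ m \<le> card X * real d ^ (k - 1)"
    by (simp add: mult_right_mono)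
  then show ?thesis
    by (metis of_nat_le_iff of_nat_mult of_nat_power)
qed

end


section \<open>Paths in rooted trees\<close>

lemma vwalk_append_iff:
  "p \<noteq> [] \<Longrightarrow> q \<noteq> [] \<Longrightarrow>
    vwalk (p @ q) G \<longleftrightarrow> vwalk p G \<and> vwalk q G \<and> (last p, hd q) \<in> arcs_ends G"
  by (auto simp: vwalk_def vwalk_arcs_append)

lemma (in sym_digraph) vwalk_rev: "vwalk p G \<Longrightarrow> vwalk (rev p) G"
  using arcs_ends_symmetric[OF sym_arcs] unfolding vwalk_def set_vwalk_arcs_rev by auto

text \<open>Bridge from vertex lists to arc walks, the terms in which acyclicity is stated.\<close>

lemma (in wf_digraph) vwalk_imp_awalk:
  "vwalk p G \<Longrightarrow> \<exists>es. awalk (hd p) es (last p) \<and> awalk_verts (hd p) es = p"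
proof (induction p rule: vwalk_induct)
  case (Base u)
  then show ?case by (intro exI[of _ "[]"]) (simp add: awalk_Nil_iff)
next
  case (Cons u v p)
  then obtain es where es: "awalk v es (last (v # p))" "awalk_verts v es = v # p" by auto
  from Cons(1) obtain e where e: "e \<in> arcs G" "tail G e = u" "head G e = v" by blast
  show ?case
    using es e by (intro exI[of _ "e # es"]) (simp add: awalk_Cons_iff)
qed

text \<open>A non-empty factor is the colour sequence of a subpath.\<close>

lemma vpath_imp_factor_free:
  assumes "anagram_free_colouring G f" "vpath p G"
  shows "factor_free (map f p)"
  unfolding factor_free_def
proof (intro allI impI)
  fix x y z assume "map f p = x @ y @ z"
  then obtain x' u where "p = x' @ u" and "y @ z = map f u"
    by (auto simp: map_eq_append_conv)
  then obtain y' z' where p: "p = x' @ y' @ z'" and y: "y = map f y'"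
    by (auto simp: append_eq_map_conv)
  show "\<not> anagram y"
  proof (cases "y' = []")
    case False
    have "vwalk (y' @ z') G"
      using assms(2) p False by (auto simp: vpath_def intro: vwalkI_append_r)
    then have "vpath y' G"
      using assms(2) p False by (auto simp: vpath_def intro: vwalkI_append_l)
    then show ?thesis using assms(1) y by (simp add: anagram_free_colouring_def)
  qed (simp add: y anagram_def)
qed

section \<open>Uniqueness of paths, and descending paths\<close>

context rooted_tree
begin

lemma no_long_vcycle:
  assumes "vwalk (a # q @ [a]) T" "distinct (a # q)" "2 \<le> length q"
  shows False
proof -
  obtain es where es: "awalk a es a" "awalk_verts a es = a # q @ [a]"
    using vwalk_imp_awalk[OF assms(1)] by auto
  have "length es = Suc (length q)"
    using length_awalk_verts[of a es] es(2) by simp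
  then have "cycle es" "3 \<le> length es"
    using es assms by (auto simp: cycle_def)
  then show False using acyclic by blast
qed

text \<open>Two paths that part at \<open>a\<close> and meet again close a cycle.\<close>

lemma vpath_unique:
  "vpath p T \<Longrightarrow> vpath q T \<Longrightarrow> hd p = hd q \<Longrightarrow> last p = last q \<Longrightarrow> p = q"
proof (induction p arbitrary: q)
  case Nil
  then show ?case by (auto simp: vpath_def)
next
  case (Cons a p)
  then obtain q' where q: "q = a # q'"
    by (cases q) (auto simp: vpath_def vwalk_def)
  consider "p = []" | "q' = []" | "p \<noteq> []" "q' \<noteq> []" by blast
  then show ?case
  proof cases
    case 1
    then show ?thesis using Cons.prems q by (auto simp: vpath_def split: if_splits)
  next
    case 2
    then show ?thesis using Cons.prems q by (auto simp: vpath_def split: if_splits)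
  next
    case 3
    have sub: "vpath p T" "vpath q' T"
      using Cons.prems q 3 by (auto simp: vpath_def elim: vwalk_consE)
    have last: "last p = last q'" using Cons.prems(4) q 3 by simp
    show ?thesis
    proof (cases "hd p = hd q'")
      case True
      then show ?thesis using Cons.IH[OF sub True last] q by simp
    next
      case False
      have "\<exists>x \<in> set p. x \<in> set q'" using 3 last by (metis last_in_set)
      \<comment> \<open>The first vertex of \<open>p\<close> on \<open>q'\<close> is chosen, so that
        \<open>p1\<close> avoids \<open>q'\<close> and the closed walk repeats no inner
        vertex.\<close>
      then obtain p1 x p2 where p: "p = p1 @ x # p2" "x \<in> set q'" "\<forall>y \<in> set p1. y \<notin> set q'"
        using split_list_first_prop[of p "\<lambda>x. x \<in> set q'"] by blast
      obtain q1 q2 where q': "q' = q1 @ x # q2" using p(2) split_list by metis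
      have "vwalk ((a # p1 @ [x]) @ p2) T" "vwalk ((a # q1 @ [x]) @ q2) T"
        using Cons.prems(1,2) p(1) q q' by (simp_all add: vpath_def)
      then have w: "vwalk ((a # p1) @ [x]) T" "vwalk (a # q1 @ [x]) T"
        using vwalkI_append_l[of "a # p1 @ [x]" p2] vwalkI_append_l[of "a # q1 @ [x]" q2] by auto
      have "vwalk (rev (a # q1 @ [x])) T" using w(2) by (rule vwalk_rev)
      then have "vwalk (x # rev q1 @ [a]) T" by simp
      moreover have "vwalk (a # p1) T" "(last (a # p1), x) \<in> arcs_ends T"
        using w(1) vwalk_append_iff[of "a # p1" "[x]" T] by auto
      ultimately have "vwalk ((a # p1) @ (x # rev q1 @ [a])) T"
        using vwalk_append_iff[of "a # p1" "x # rev q1 @ [a]" T] by auto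
      then have "vwalk (a # (p1 @ x # rev q1) @ [a]) T" by simp
      moreover have "distinct (a # p1 @ x # rev q1)"
        using Cons.prems(1,2) p q q' by (auto simp: vpath_def)
      \<comment> \<open>Since the first steps differ, \<open>p1\<close> and \<open>q1\<close> are
        not both empty.\<close>
      moreover have "2 \<le> length (p1 @ x # rev q1)"
        using False p(1) q' by (cases p1; cases q1) auto
      ultimately show ?thesis using no_long_vcycle by blast
    qed
  qed
qed

lemma graph_dist_root: "graph_dist T r r = 0"
  unfolding graph_dist_def
  by (rule Least_eq_0) (intro exI[of _ "[r]"], simp add: vpath_self root)

lemma graph_dist_le_height: "v \<in> verts T \<Longrightarrow> graph_dist T r v \<le> tree_height T r"
  unfolding tree_height_def by (intro Max_ge) auto

lemma children_in_verts: "w \<in> children T r v \<Longrightarrow> w \<in> verts T"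
  by (auto simp: children_def adj_in_verts)

text \<open>Height minus depth drops at every step down; no depth exceeds the height, so truncated
  subtraction is harmless.\<close>

sublocale ranked_tree "children T r" "\<lambda>v. tree_height T r - graph_dist T r v"
proof
  show "finite (children T r v)" for v
    by (rule finite_subset[of _ "verts T"]) (auto dest: children_in_verts)
next
  fix v w assume "w \<in> children T r v"
  then show "tree_height T r - graph_dist T r w < tree_height T r - graph_dist T r v"
    using graph_dist_le_height[OF children_in_verts] by (fastforce simp: children_def)
qed

abbreviation descending :: "'a \<Rightarrow> 'a list \<Rightarrow> bool" where
  "descending \<equiv> descent (children T r)"

text \<open>The bound on depths is carried along because it shows that the path never returns to
  \<open>v\<close>.\<close>

lemma descending_properties:
  "descending v p \<Longrightarrow> v \<in> verts T \<Longrightarrow>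
     vpath p T \<and> hd p = v \<and> last p \<in> leaves T r \<and> (\<forall>u \<in> set p. graph_dist T r v \<le> graph_dist T r u) \<and>
     Suc (graph_dist T r (last p)) = graph_dist T r v + length p"
proof (induction rule: descent.induct)
  case (leaf v)
  then show ?case by (auto simp: vpath_self leaves_def)
next
  case (step w v p)
  then have w: "w \<in> verts T" "v \<rightarrow>\<^bsub>T\<^esub> w" "graph_dist T r w = Suc (graph_dist T r v)"
    using children_in_verts by (auto simp: children_def)
  note IH = step.IH[OF w(1)]
  then have "p \<noteq> []" by (auto simp: vpath_def)
  have "v \<notin> set p" using IH w(3) by fastforce
  then have "vpath (v # p) T"
    using IH w(2) step.prems by (simp add: vpath_def vwalk_consI)
  moreover have "\<forall>u \<in> set (v # p). graph_dist T r v \<le> graph_dist T r u"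
    using IH w(3) by auto
  ultimately show ?case using IH w(3) \<open>p \<noteq> []\<close> by simp
qed

lemma length_descending: "descending r p \<Longrightarrow> length p \<le> Suc (tree_height T r)"
  using descending_properties[of r p] graph_dist_le_height[of "last p"]
  by (auto simp: graph_dist_root root leaves_def)

abbreviation branching :: "'a \<Rightarrow> bool" where
  "branching u \<equiv> 2 \<le> card (children T r u)"

text \<open>By uniqueness a descending path is the \<open>tree_path\<close> to its leaf, hence among
  the paths of the minimum.\<close>

lemma effective_height_le:
  assumes "descending r p"
  shows "effective_height T r \<le> length (filter branching p)"
proof -
  have p: "vpath p T" "hd p = r" "last p \<in> leaves T r"
    using descending_properties[OF assms root] by auto
  have path: "tree_path T r (last p) = p"
    unfolding tree_path_def using p vpath_unique by (intro the_equality) auto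
  have "set p \<inter> branch_vertices T r = set (filter branching p)"
    using p by (auto simp: branch_vertices_def vpath_def vwalk_def)
  moreover have "card (set (filter branching p)) = length (filter branching p)"
    using p by (intro distinct_card distinct_filter) (simp add: vpath_def)
  moreover have "effective_height T r \<le> card (set (tree_path T r (last p)) \<inter> branch_vertices T r)"
    unfolding effective_height_def using p(3)
    by (intro Min_le finite_imageI finite_subset[of "leaves T r" "verts T"]) (auto simp: leaves_def)
  ultimately show ?thesis by (simp add: path)
qed

lemma descending_in_verts: "descending r (x @ w # p) \<Longrightarrow> w \<in> verts T"
  using descending_properties[of r "x @ w # p"] root by (auto simp: vpath_def vwalk_def)

text \<open>After separating at \<open>w\<close> the two paths never meet again, by uniqueness of
  paths; so one can be climbed and the other descended.\<close>

lemma vpath_through_branch: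
  assumes p: "descending r (x @ w # p)" and q: "descending r (x @ w # q)"
    and ne: "p \<noteq> []" "q \<noteq> []" "hd p \<noteq> hd q"
  shows "vpath (rev p @ w # q) T"
proof -
  have w: "w \<in> verts T" using p by (rule descending_in_verts)
  have vp: "vpath (w # p) T" "vpath (w # q) T"
    using descending_properties[OF descent_split[OF p refl] w]
      descending_properties[OF descent_split[OF q refl] w] by auto
  have "set p \<inter> set q = {}"
  proof (rule ccontr)
    assume "set p \<inter> set q \<noteq> {}"
    then obtain y where "y \<in> set p" "y \<in> set q" by blast
    then obtain p1 p2 q1 q2 where y: "p = p1 @ y # p2" "q = q1 @ y # q2"
      by (metis split_list)
    have "vpath (w # p1 @ [y]) T" "vpath (w # q1 @ [y]) T"
      using vp vwalkI_append_l[of "w # p1 @ [y]" p2] vwalkI_append_l[of "w # q1 @ [y]" q2]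
      unfolding y by (auto simp: vpath_def)
    then have "p1 = q1" using vpath_unique[of "w # p1 @ [y]" "w # q1 @ [y]"] by simp
    then show False using ne(3) y by (cases p1) auto
  qed
  then have "distinct (rev p @ w # q)" using vp by (auto simp: vpath_def)
  moreover have "vwalk (rev p @ w # q) T"
  proof -
    have "vwalk (rev (w # p)) T" using vp(1) by (intro vwalk_rev) (simp add: vpath_def)
    then show ?thesis
      using ne vp(2) by (simp add: vwalk_append_iff vpath_def)
  qed
  ultimately show ?thesis by (simp add: vpath_def)
qed

lemma vpath_through_branch_prefix:
  assumes "descending r (x @ w # p1 @ p2)" "descending r (x @ w # q1 @ q2)"
    and "p1 \<noteq> []" "q1 @ q2 \<noteq> []" "hd p1 \<noteq> hd (q1 @ q2)"
  shows "vpath (rev p1 @ w # q1) T"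
proof -
  have v: "vpath (rev p2 @ (rev p1 @ w # q1) @ q2) T"
    using vpath_through_branch[OF assms(1,2)] assms(3-) by simp
  have "vwalk ((rev p1 @ w # q1) @ q2) T"
    by (rule vwalkI_append_r[of _ "rev p2"]) (use v in \<open>auto simp: vpath_def\<close>)
  then have "vwalk (rev p1 @ w # q1) T"
    by (rule vwalkI_append_l[rotated]) simp
  moreover have "distinct (rev p1 @ w # q1)" using v by (simp add: vpath_def Int_Un_distrib)
  ultimately show ?thesis by (simp only: vpath_def)
qed

lemma descending_replace:
  "descending v (x @ w # p) \<Longrightarrow> descending w (w # q) \<Longrightarrow> descending v (x @ w # q)"
proof (induction x arbitrary: v)
  case Nil
  then show ?case by (auto elim: descent.cases)
next
  case (Cons a x)
  from Cons.prems(1) show ?case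
    by (cases rule: descent.cases) (use Cons in \<open>auto intro: descent.intros\<close>)
qed

lemma descending_length:
  assumes "descending v p"
  shows "length (filter branching p) < length p"
  using assms by (induction rule: descent.induct) auto

text \<open>Two descents from different children of the first branch vertex \<open>w\<close> of a
  descending path are joined through \<open>w\<close>.\<close>

lemma long_vpath: "\<exists>p. vpath p T \<and> 2 * effective_height T r < length p"
proof (cases "effective_height T r = 0")
  case True
  then show ?thesis using root vpath_self[of r T] by (intro exI[of _ "[r]"]) simp
next
  case False
  obtain P where P: "descending r P"
    using descents_nonempty[of r] by (auto simp: descents_def)
  have "filter branching P \<noteq> []" using effective_height_le[OF P] False by auto
  then have "\<exists>u \<in> set P. branching u" by (simp add: filter_empty_conv)
  then obtain x w p where w: "P = x @ w # p" "branching w" "\<forall>u \<in> set x. \<not> branching u"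
    using split_list_first_prop[of P branching] by metis
  have "descending w (w # p)" using descent_split[OF P w(1)] .
  then obtain w1 where w1: "descending w1 p"
    using w(2) by (cases rule: descent.cases) auto
  then have "p \<noteq> []" by (auto elim: descent.cases)
  obtain w2 where w2: "w2 \<in> children T r w" "w2 \<noteq> hd p"
  proof -
    have "\<not> children T r w \<subseteq> {hd p}"
      using w(2) card_mono[of "{hd p}" "children T r w"] by auto
    then show ?thesis using that by blast
  qed
  obtain q where q: "descending w2 q"
    using descents_nonempty[of w2] by (auto simp: descents_def)
  have wq: "descending w (w # q)" using w2(1) q by (rule descent.step)
  have Q: "descending r (x @ w # q)"
    using descending_replace[OF P[unfolded w(1)] wq] .
  have "q \<noteq> []" "hd q = w2" using q by (auto elim: descent.cases)
  have "vpath (rev p @ w # q) T"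
    using vpath_through_branch[OF P[unfolded w(1)] Q \<open>p \<noteq> []\<close> \<open>q \<noteq> []\<close>] w2 \<open>hd q = w2\<close> by metis
  \<comment> \<open>Above the arms only \<open>w\<close> branches, so each arm has at least
    \<open>effective_height T r - 1\<close> branch vertices, and its leaf besides.\<close>
  moreover have "effective_height T r \<le> length p" "effective_height T r \<le> length q"
    using effective_height_le[OF P] effective_height_le[OF Q] w
      descending_length[OF w1] descending_length[OF q] by (auto simp: filter_empty_conv)
  ultimately show ?thesis by (intro exI[of _ "rev p @ w # q"]) simp
qed

end


section \<open>Coloured trees\<close>

lemma card_ordered_pairs: "2 * card {(a, b). a \<le> b \<and> b < k} = k * Suc k" for k :: nat
proof -
  have "{(a, b). a \<le> b \<and> b < k} = prod.swap ` (SIGMA b:{..<k}. {..b})" by auto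
  then have "card {(a, b). a \<le> b \<and> b < k} = card (SIGMA b:{..<k}. {..b})"
    by (simp add: card_image)
  also have "\<dots> = (\<Sum>b<k. Suc b)" by simp
  finally have "card {(a, b). a \<le> b \<and> b < k} = (\<Sum>b<k. Suc b)" .
  moreover have "2 * (\<Sum>b<k. Suc b) = k * Suc k" by (induction k) auto
  ultimately show ?thesis by simp
qed

locale coloured_tree = rooted_tree T r for T :: "('a, 'b) pre_digraph" and r +
  fixes f :: "'a \<Rightarrow> nat" and k :: nat
  assumes colours: "f ` verts T \<subseteq> {..<k}"
    and anagram_free: "anagram_free_colouring T f"
begin

text \<open>Anagram-free words over at most 1, 2, 3 letters have length at most 1, 3, 7, so twice
  the effective height is at most 0, 2, 6.\<close>

lemma few_colours: "k \<le> 3 \<Longrightarrow> 2 * effective_height T r \<le> k\<^sup>2"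
proof -
  assume "k \<le> 3"
  obtain p where p: "vpath p T" "2 * effective_height T r < length p"
    using long_vpath by blast
  have "factor_free (map f p)" "set (map f p) \<subseteq> {..<k}"
    using vpath_imp_factor_free[OF anagram_free p(1)] p(1) colours by (auto simp: vpath_def vwalk_def)
  from factor_free_length[OF this] p(2) have
    "k \<le> 1 \<Longrightarrow> effective_height T r = 0" "k = 2 \<Longrightarrow> effective_height T r \<le> 1"
    "k = 3 \<Longrightarrow> effective_height T r \<le> 3" by auto
  moreover have "k \<le> 1 \<or> k = 2 \<or> k = 3" using \<open>k \<le> 3\<close> by auto
  ultimately show ?thesis by auto
qed

text \<open>The root is common to all paths; dropping it leaves at most
  \<open>tree_height T r\<close> letters. The restriction makes the set of possible codes a finite
  \<open>PiE\<close>.\<close>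

definition codes :: "'a list \<Rightarrow> nat \<times> nat \<Rightarrow> nat" where
  "codes p = restrict (pair_code (map f (tl p))) {(a, b). a \<le> b \<and> b < k}"

lemma codes_lossy: "lossy_family f {p \<in> descents (children T r) r. codes p = c}"
  unfolding lossy_family_def
proof (intro allI impI notI)
  fix x w p q
  assume P: "x @ w # p \<in> {p \<in> descents (children T r) r. codes p = c}"
    and Q: "x @ w # q \<in> {p \<in> descents (children T r) r. codes p = c}"
    and ne: "p \<noteq> []" "q \<noteq> []" "hd p \<noteq> hd q" and fw: "f w \<in> f ` set p"
  define s where "s = map f (tl (x @ [w]))"
  have tl: "map f (tl (x @ w # y)) = s @ map f y" for y
    unfolding s_def by (cases x) simp_all
  have d: "descending r (x @ w # p)" "descending r (x @ w # q)"
    using P Q by (auto simp: descents_def)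
  have V: "set (x @ w # p) \<subseteq> verts T" "set (x @ w # q) \<subseteq> verts T"
    using descending_properties[OF d(1) root] descending_properties[OF d(2) root]
    by (auto simp: vpath_def vwalk_def)
  have letters: "set (s @ map f y) \<subseteq> {..<k}" if "set (x @ w # y) \<subseteq> verts T" for y
  proof -
    have "set (tl (x @ w # y)) \<subseteq> set (x @ w # y)" by (cases x) auto
    then have "f ` set (tl (x @ w # y)) \<subseteq> {..<k}" using that colours by blast
    then show ?thesis unfolding tl[symmetric] by simp
  qed
  have "codes (x @ w # p) (a, b) = codes (x @ w # q) (a, b)" for a b using P Q by simp
  then have eq: "pair_code (s @ map f p) (a, b) = pair_code (s @ map f q) (a, b)"
    if "a \<le> b" "b < k" for a b
    using that unfolding codes_def tl restrict_def by (metis (mono_tags, lifting) case_prodI mem_Collect_eq)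
  obtain p1 p2 q1 q2 where *: "map f p = p1 @ f w # p2" "map f q = q1 @ f w # q2"
      "anagram (f w # rev p1 @ f w # q1)"
    using anagram_of_equal_codes[of k s "map f p" "map f q" "f w", OF eq letters[OF V(1)] letters[OF V(2)]] fw
    by auto
  obtain p1' u p2' where p: "p = p1' @ u # p2'" "p1 = map f p1'" "f w = f u"
    using *(1) by (auto simp: map_eq_append_conv map_eq_Cons_conv)
  obtain q1' v q2' where q: "q = q1' @ v # q2'" "q1 = map f q1'"
    using *(2) by (auto simp: map_eq_append_conv map_eq_Cons_conv)
  \<comment> \<open>The path climbs from \<open>u\<close> to \<open>w\<close> and descends along
    \<open>q\<close>, stopping just before \<open>v\<close>; its colours form the anagram.\<close>
  have "vpath (rev (p1' @ [u]) @ w # q1') T"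
  proof (rule vpath_through_branch_prefix)
    show "descending r (x @ w # (p1' @ [u]) @ p2')" "descending r (x @ w # q1' @ v # q2')"
      using d p(1) q(1) by simp_all
    show "hd (p1' @ [u]) \<noteq> hd (q1' @ v # q2')"
      using ne(3) p(1) q(1) by (cases p1') simp_all
  qed simp_all
  then have "\<not> anagram (map f (rev (p1' @ [u]) @ w # q1'))"
    by (rule anagram_free[unfolded anagram_free_colouring_def, rule_format])
  moreover have "map f (rev (p1' @ [u]) @ w # q1') = f w # rev p1 @ f w # q1"
    using p(2,3) q(2) by (simp add: rev_map)
  ultimately show False using *(3) by metis
qed

lemma branching_count:
  assumes "0 < d" "\<And>v. v \<in> branch_vertices T r \<Longrightarrow> d \<le> card (children T r v)"
    and "2 \<le> tree_height T r"
  shows "d ^ effective_height T r \<le> tree_height T r ^ card {(a, b). a \<le> b \<and> b < k} * d ^ (k - 1)"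
proof -
  define I where "I = {(a, b). a \<le> b \<and> b < k}"
  define X where "X = PiE I (\<lambda>_. {..<tree_height T r})"
  have "I \<subseteq> {..<k} \<times> {..<k}" by (auto simp: I_def)
  then have finI: "finite I" by (rule finite_subset) simp
  have sub: "set p \<subseteq> verts T" if "p \<in> descents (children T r) r" for p
    using that descending_properties[of r p] root by (auto simp: descents_def vpath_def vwalk_def)
  have "d ^ effective_height T r \<le> card X * d ^ (k - 1)"
  proof (rule branching_bound[where v = r and f = f and \<Phi> = codes])
    fix p assume p: "p \<in> descents (children T r) r"
    show "effective_height T r \<le> length (filter branching p)"
      using p by (intro effective_height_le) (simp add: descents_def)
    have "f ` set p \<subseteq> {..<k}" using sub[OF p] colours by blast
    then show "card (f ` set p) \<le> k" using card_mono[of "{..<k}" "f ` set p"] by simp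
    have vp: "vpath p T" and len: "length p \<le> Suc (tree_height T r)"
      using p descending_properties[of r p] length_descending root by (auto simp: descents_def)
    have "factor_free (map f p)" using vpath_imp_factor_free[OF anagram_free vp] .
    then have "factor_free (map f (tl p))"
      by (cases p) (auto dest: factor_free_Cons)
    then have "pair_code (map f (tl p)) (a, b) < tree_height T r" for a b
      using len assms(3) by (intro pair_code_less) auto
    then show "codes p \<in> X" by (auto simp: codes_def X_def I_def)
    fix u assume "u \<in> set p" "branching u"
    then show "d \<le> card (children T r u)"
      using sub[OF p] assms(2) by (auto simp: branch_vertices_def)
  next
    show "finite X" unfolding X_def using finI by (intro finite_PiE) auto
  qed (use assms(1) codes_lossy in auto)
  moreover have "card X = tree_height T r ^ card I"
    unfolding X_def using finI by (simp add: card_PiE)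
  ultimately show ?thesis by (simp add: I_def)
qed

lemma branching_power_bound:
  fixes h :: real
  assumes "0 < d" "\<And>v. v \<in> branch_vertices T r \<Longrightarrow> d \<le> card (children T r v)"
    and h: "2 \<le> h" "real d \<le> h\<^sup>2" "tree_height T r \<le> h"
  shows "real d ^ effective_height T r \<le> h ^ k\<^sup>2"
proof (cases "2 * effective_height T r \<le> k\<^sup>2")
  case True
  have "real d ^ effective_height T r \<le> (h\<^sup>2) ^ effective_height T r"
    using h by (intro power_mono) auto
  also have "\<dots> \<le> h ^ k\<^sup>2"
    unfolding power_mult[symmetric] using True h by (intro power_increasing) auto
  finally show ?thesis .
next
  case False
  then have "4 \<le> k" using few_colours by (cases "k \<le> 3") auto
  then have "k\<^sup>2 \<ge> 4 * 4" unfolding power2_eq_square by (intro mult_mono) auto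
  then have "2 < effective_height T r" using False by simp
  \<comment> \<open>A descending path has more vertices than branch vertices, so the height is at
    least the effective height.\<close>
  have "2 \<le> tree_height T r"
  proof -
    obtain p where p: "descending r p"
      using descents_nonempty[of r] by (auto simp: descents_def)
    then show ?thesis
      using effective_height_le[OF p] length_descending[OF p] descending_length[OF p]
        \<open>2 < effective_height T r\<close> by simp
  qed
  define n where "n = card {(a, b). a \<le> b \<and> b < k}"
  have n: "2 * n = k * Suc k" unfolding n_def by (rule card_ordered_pairs)
  \<comment> \<open>Doubled, this says \<open>(k - 1) * (k - 4) \<ge> 0\<close>; the summand
    \<open>2 * (k - 1)\<close> comes from \<open>d \<le> h\<^sup>2\<close>.\<close>
  have exp: "n + 2 * (k - 1) \<le> k\<^sup>2"
  proof -
    obtain j where "k = 4 + j" using \<open>4 \<le> k\<close> le_Suc_ex by blast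
    with n show ?thesis by (simp add: power2_eq_square algebra_simps)
  qed
  have "real d ^ effective_height T r \<le> real (tree_height T r ^ n * d ^ (k - 1))"
    using of_nat_mono[OF branching_count[OF assms(1,2) \<open>2 \<le> tree_height T r\<close>], where 'a = real]
    unfolding n_def by simp
  also have "\<dots> = real (tree_height T r) ^ n * real d ^ (k - 1)" by simp
  also have "\<dots> \<le> h ^ n * (h\<^sup>2) ^ (k - 1)"
    using h by (intro mult_mono power_mono) auto
  also have "\<dots> = h ^ (n + 2 * (k - 1))" by (simp add: power_add power_mult)
  also have "\<dots> \<le> h ^ k\<^sup>2" using exp h by (intro power_increasing) auto
  finally show ?thesis .
qed

end

text \<open>Giving all vertices different colours is anagram-free, so the minimum is
  attained.\<close>

lemma (in fin_digraph) anagram_free_colourable_chromatic_number: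
  "anagram_free_colourable G (\<phi> G)"
proof -
  obtain f :: "'a \<Rightarrow> nat" where f: "bij_betw f (verts G) {..<card (verts G)}"
    using ex_bij_betw_finite_nat[OF finite_verts] by (auto simp: atLeast0LessThan)
  have "anagram_free_colouring G f"
    unfolding anagram_free_colouring_def
  proof (intro allI impI notI)
    fix p assume p: "vpath p G" and "anagram (map f p)"
    then obtain W P where W: "map f p = W @ P" "W \<noteq> []" "set P = set W"
      unfolding anagram_def by (metis set_mset_mset)
    have "inj_on f (set p)"
      using f p by (auto simp: bij_betw_def vpath_def vwalk_def intro: inj_on_subset)
    then have "distinct (W @ P)"
      using p unfolding W(1)[symmetric] by (simp add: distinct_map vpath_def)
    then show False using W by (cases W) auto
  qed
  then have "anagram_free_colourable G (card (verts G))"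
    unfolding anagram_free_colourable_def using f by (auto simp: bij_betw_def)
  then show ?thesis unfolding anagram_chromatic_number_def by (rule LeastI)
qed

theorem theorem12:
  fixes T :: "('a, 'b) pre_digraph" and r :: 'a
    and d h' :: nat and h :: real
  assumes "2 \<le> d"
    and "max 2 (sqrt (real d)) \<le> h"
    and "branch_tree d T r"
    and "h' \<le> effective_height T r"
    and "real (tree_height T r) \<le> h"
  shows "\<lceil>sqrt (real h' / log (real d) h)\<rceil> \<le> int (\<phi> T)"
proof -
  interpret rooted_tree T r using assms(3) by (simp add: branch_tree_def)
  obtain f :: "'a \<Rightarrow> nat" where "f ` verts T \<subseteq> {..<\<phi> T}" "anagram_free_colouring T f"
    using anagram_free_colourable_chromatic_number by (auto simp: anagram_free_colourable_def)
  then interpret coloured_tree T r f "\<phi> T" by unfold_locales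
  have h: "2 \<le> h" "sqrt d \<le> h" using assms(2) by auto
  have "real d \<le> h\<^sup>2" using power_mono[OF h(2), of 2] by simp
  then have "real d ^ effective_height T r \<le> h ^ (\<phi> T)\<^sup>2"
    using assms h by (intro branching_power_bound) (auto simp: branch_tree_def)
  then have "real d ^ h' \<le> h ^ (\<phi> T)\<^sup>2"
    using power_increasing[OF assms(4), of "real d"] assms(1) by linarith
  then have "log d (real d ^ h') \<le> log d (h ^ (\<phi> T)\<^sup>2)"
    using assms(1) h by (subst log_le_cancel_iff) auto
  then have "real h' \<le> (\<phi> T)\<^sup>2 * log d h"
    using assms(1) h by (simp add: log_nat_power)
  moreover have "0 < log d h" using assms(1) h by simp
  ultimately have "real h' / log d h \<le> (real (\<phi> T))\<^sup>2"
    by (simp add: pos_divide_le_eq)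
  then have "sqrt (real h' / log d h) \<le> real (\<phi> T)"
    by (rule real_le_lsqrt[rotated]) simp
  then show ?thesis by (simp add: ceiling_le_iff)
qed

end
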